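(* Let $A\in\mathbb{R}^{n\times n}$, $B\in\mathbb{R}^{n\times m}$, let $(\boldsymbol x_{\mathrm{eq}},\boldsymbol u_{\mathrm{eq}})$ satisfy $A\boldsymbol x_{\mathrm{eq}}+B\boldsymbol u_{\mathrm{eq}}=\boldsymbol 0$, let $P\in\mathbb{R}^{n\times n}$ be symmetric positive definite, and put $V(\boldsymbol x)=(\boldsymbol x-\boldsymbol x_{\mathrm{eq}})^\top P(\boldsymbol x-\boldsymbol x_{\mathrm{eq}})$. Let $\tau_{\min}>0$, let $V_{\mathrm{crit}}>0$ be the safety threshold, and let $$G_1:=\sup_{\boldsymbol x\neq \boldsymbol 0}\sqrt{\frac{\boldsymbol x^\top (e^{A\tau_{\min}})^\top P\, e^{A\tau_{\min}}\boldsymbol x}{\boldsymbol x^\top P\boldsymbol x}}.$$ Consider the plant $\dot{\boldsymbol x}=A\boldsymbol x+B\boldsymbol u$ under a self-triggered controller that satisfies, with rate $\lambda>0$, the exponential-decay Lyapunov contract $V(\hat{\boldsymbol x}(t_k+\tau^d))\le V(\boldsymbol x_k)\exp(-\lambda\tau^d)$ at each unjammed decision, and a hold-last medium-access-control (MAC) jamming adversary whose first jam decision occurs at $t=0$ from an initial state $\boldsymbol x_0$ with $V(\boldsymbol x_0)=V_0$ and $0<V_0<V_{\mathrm{crit}}$. During a jam window the held input is $\boldsymbol u_{\mathrm{eq}}$. Assume $G_1>1$. Let $N^\star$ be the minimum number of ticks $N$ (each of length $\tau_{\min}$) in a single contiguous jam block, starting at $t=0$, required to drive $V(\boldsymbol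 x_T)\ge V_{\mathrm{crit}}$, where $\boldsymbol x_T$ is the state at the end $T=N\tau_{\min}$ of the block ($N^\star=+\infty$ if no such $N$ exists). Then $$N^\star\ \ge\ \left\lceil \frac{\log\left(V_{\mathrm{crit}}/V_0\right)}{2\log G_1}\right\rceil .$$
   Context: The plant is represented over a jam window by its linearization $\dot{\boldsymbol x}=A\boldsymbol x+B\boldsymbol u$ about the equilibrium. The safety region is $\{\boldsymbol x: V(\boldsymbol x)\le V_{\mathrm{crit}}\}$, and a crash means reaching $V\ge V_{\mathrm{crit}}$. Self-triggered controller (STC): at each decision instant $t_k$, with state $\boldsymbol x_k=\boldsymbol x(t_k)$, it selects an input $\boldsymbol u_k$ and a dwell time $\tau^d\in\{\tau_{\min},2\tau_{\min},\dots,N_\tau\tau_{\min}\}$ (for a fixed integer $N_\tau\ge 1$), and the input is held constant on $[t_k,t_k+\tau^d)$; $\hat{\boldsymbol x}(t_k+\tau^d)$ is the resulting state at the end of that interval. Hold-last MAC adversary: during a jam window no control update reaches the actuator, which keeps applying the last delivered input. When that held input equals $\boldsymbol u_{\mathrm{eq}}$, the deviation $\delta\boldsymbol x:=\boldsymbol x-\boldsymbol x_{\mathrm{eq}}$ obeys $\dot{(\delta\boldsymbol x)}=A\,\delta\boldsymbol x$ in the window, so $\delta\boldsymbol x(t+\tau)=e^{A\tau}\delta\boldsymbol x(t)$. *)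

theory Defs
  imports "HOL-Analysis.Analysis" "HOL-Library.Extended_Nat"
begin

(* Powers are iterated matrix products: the type class operations * and ^ on
   real^'n^'n act componentwise, so ^ must not be used here. *)
definition mat_exp :: "real^'n^'n \<Rightarrow> real^'n^'n" where
  "mat_exp A = (\<Sum>k. (((**) A ^^ k) (mat 1)) /\<^sub>R fact k)"

definition pos_def_matrix :: "real^'n^'n \<Rightarrow> bool" where
  "pos_def_matrix P \<longleftrightarrow> transpose P = P \<and> (\<forall>x. x \<noteq> 0 \<longrightarrow> 0 < x \<bullet> (P *v x))"

definition lyapunov :: "real^'n^'n \<Rightarrow> real^'n \<Rightarrow> real^'n \<Rightarrow> real" where
  "lyapunov P xeq x = (x - xeq) \<bullet> (P *v (x - xeq))"

definition one_tick_gain :: "real^'n^'n \<Rightarrow> real^'n^'n \<Rightarrow> real \<Rightarrow> real" where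
  "one_tick_gain A P \<tau> =
     (SUP x\<in>{x. x \<noteq> 0}.
        sqrt ((x \<bullet> ((transpose (mat_exp (\<tau> *\<^sub>R A)) ** P ** mat_exp (\<tau> *\<^sub>R A)) *v x))
              / (x \<bullet> (P *v x))))"

definition solves_on ::
  "real^'n^'n \<Rightarrow> real^'m^'n \<Rightarrow> real^'m \<Rightarrow> (real \<Rightarrow> real^'n) \<Rightarrow> real \<Rightarrow> real \<Rightarrow> bool" where
  "solves_on A B u x a b \<longleftrightarrow>
     (\<forall>t\<in>{a..b}. (x has_vector_derivative (A *v x t + B *v u)) (at t within {a..b}))"

(* Closed loop on [0, infinity) when the ticks 0, ..., N - 1 are jammed, that is, the
   jam window is [0, N * \<tau>).
   stc t y = (u, d): at a decision instant t with state y the controller selects the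
   input u and the dwell time d * \<tau>.
   u0: the last input delivered to the actuator before time 0.
   i k: tick index of the k-th decision, so t_k = i k * \<tau>.
   w k: input actually applied on [t_k, t_(k+1)). A decision taken inside the jam window
   does not reach the actuator, which keeps the input applied before. *)
definition jam_run ::
  "real^'n^'n \<Rightarrow> real^'m^'n \<Rightarrow> real \<Rightarrow> (real \<Rightarrow> real^'n \<Rightarrow> (real^'m) \<times> nat) \<Rightarrow> real^'m \<Rightarrow> real^'n \<Rightarrow>
   nat \<Rightarrow> (nat \<Rightarrow> nat) \<Rightarrow> (nat \<Rightarrow> real^'m) \<Rightarrow> (real \<Rightarrow> real^'n) \<Rightarrow> bool" where
  "jam_run A B \<tau> stc u0 x0 N i w x \<longleftrightarrow>
     x 0 = x0 \<and> i 0 = 0 \<and>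
     (\<forall>k. let t = real (i k) * \<tau>; (u, d) = stc t (x t) in
        i (Suc k) = i k + d \<and>
        w k = (if i k < N then (case k of 0 \<Rightarrow> u0 | Suc j \<Rightarrow> w j) else u) \<and>
        solves_on A B (w k) x t (real (i (Suc k)) * \<tau>))"

(* Exponential-decay contract V(xhat(t_k + tau^d)) \<le> V(x_k) exp(-lam tau^d) at every decision
   outside the jam window. The input selected there is held on the whole dwell interval,
   hence xhat(t_k + tau^d) is the state x (t_(k+1)) of the run. *)
definition decay_contract ::
  "(real^'n \<Rightarrow> real) \<Rightarrow> real \<Rightarrow> real \<Rightarrow> nat \<Rightarrow> (nat \<Rightarrow> nat) \<Rightarrow> (real \<Rightarrow> real^'n) \<Rightarrow> bool" where
  "decay_contract V lam \<tau> N i x \<longleftrightarrow>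
     (\<forall>k. N \<le> i k \<longrightarrow>
        (let t = real (i k) * \<tau>; t' = real (i (Suc k)) * \<tau> in
           V (x t') \<le> V (x t) * exp (- lam * (t' - t))))"

(* Infimum in enat: the least such N, and \<infinity> if there is none. *)
definition min_crash_ticks ::
  "real^'n^'n \<Rightarrow> real^'m^'n \<Rightarrow> real \<Rightarrow> (real \<Rightarrow> real^'n \<Rightarrow> (real^'m) \<times> nat) \<Rightarrow> real^'m \<Rightarrow> real^'n \<Rightarrow>
   (real^'n \<Rightarrow> real) \<Rightarrow> real \<Rightarrow> enat" where
  "min_crash_ticks A B \<tau> stc u0 x0 V Vcrit =
     Inf {enat N | N. \<exists>i w x. jam_run A B \<tau> stc u0 x0 N i w x \<and> Vcrit \<le> V (x (real N * \<tau>))}"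

end

theory Submission
  imports Defs
begin

section \<open>Exponential series of a bounded operator and linear differential equations\<close>

lemma bounded_linear_funpow_bound:
  fixes L :: "'a::real_normed_vector \<Rightarrow> 'a"
  assumes "bounded_linear L"
  obtains K where "0 < K" "\<And>k x. norm ((L ^^ k) x) \<le> K ^ k * norm x"
proof -
  obtain K where K: "0 < K" "\<And>x. norm (L x) \<le> norm x * K"
    using bounded_linear.pos_bounded[OF assms] by blast
  have "norm ((L ^^ k) x) \<le> K ^ k * norm x" for k x
  proof (induction k)
    case (Suc k)
    have "norm ((L ^^ Suc k) x) \<le> norm ((L ^^ k) x) * K"
      using K(2) by simp
    also have "\<dots> \<le> K ^ k * norm x * K"
      using Suc K(1) by (intro mult_right_mono) auto
    finally show ?case by (simp add: mult_ac)
  qed simp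
  with K(1) show ?thesis by (rule that)
qed

lemma summable_funpow_over_fact:
  fixes L :: "'a::banach \<Rightarrow> 'a"
  assumes "bounded_linear L"
  shows "summable (\<lambda>k. (L ^^ k) x /\<^sub>R fact k)"
proof -
  obtain K where K: "0 < K" "\<And>k x. norm ((L ^^ k) x) \<le> K ^ k * norm x"
    using bounded_linear_funpow_bound[OF assms] by blast
  have "norm ((L ^^ k) x /\<^sub>R fact k) \<le> inverse (fact k) * K ^ k * norm x" for k
    using K(2)[of k x] by (simp add: mult.assoc mult_left_mono)
  moreover have "summable (\<lambda>k. inverse (fact k) * K ^ k * norm x)"
    by (intro summable_mult2 summable_exp)
  ultimately show ?thesis
    by (rule summable_comparison_test'[where N = 0, rotated])
qed

text \<open>The derivatives of the summands of
  \<open>\<Sum>k\<le>n. ((b - s) ^ k / fact k) *\<^sub>R (L ^^ k) (y s)\<close> telescope, so this function of \<open>s\<close> is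
  constant up to an error that vanishes as \<open>n\<close> grows; its value at \<open>b\<close> is \<open>y b\<close>.\<close>

lemma linear_ode_sums:
  fixes L :: "'a::real_normed_vector \<Rightarrow> 'a"
  assumes L: "bounded_linear L" and ab: "a \<le> b"
    and y: "\<And>t. t \<in> {a..b} \<Longrightarrow> (y has_vector_derivative L (y t)) (at t within {a..b})"
  shows "(\<lambda>k. ((b - a) ^ k / fact k) *\<^sub>R (L ^^ k) (y a)) sums y b"
proof -
  define z where "z n s = (\<Sum>k\<le>n. ((b - s) ^ k / fact k) *\<^sub>R (L ^^ k) (y s))" for n s
  obtain K where K: "0 < K" "\<And>k x. norm ((L ^^ k) x) \<le> K ^ k * norm x"
    using bounded_linear_funpow_bound[OF L] by blast
  have bl: "bounded_linear (L ^^ k)" for k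
  proof (induction k)
    case (Suc k)
    show ?case using bounded_linear_compose[OF L Suc] by (simp add: o_def)
  qed (simp add: bounded_linear_ident id_def)
  have dy: "((\<lambda>s. (L ^^ k) (y s)) has_vector_derivative (L ^^ Suc k) (y t)) (at t within {a..b})"
    if "t \<in> {a..b}" for t k
    using bounded_linear.has_vector_derivative[OF bl y[OF that]] by (simp add: funpow_swap1)
  have dz: "(z n has_vector_derivative ((b - t) ^ n / fact n) *\<^sub>R (L ^^ Suc n) (y t))
      (at t within {a..b})" if t: "t \<in> {a..b}" for n t
  proof (induction n)
    case 0
    show ?case using y[OF t] by (simp add: z_def)
  next
    case (Suc n)
    have "((\<lambda>s. (b - s) ^ Suc n / fact (Suc n)) has_field_derivative - ((b - t) ^ n / fact n))
        (at t within {a..b})"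
      by (rule derivative_eq_intros refl | simp add: field_simps del: of_nat_Suc)+
    then have "((\<lambda>s. ((b - s) ^ Suc n / fact (Suc n)) *\<^sub>R (L ^^ Suc n) (y s)) has_vector_derivative
        ((b - t) ^ Suc n / fact (Suc n)) *\<^sub>R (L ^^ Suc (Suc n)) (y t)
          + - ((b - t) ^ n / fact n) *\<^sub>R (L ^^ Suc n) (y t)) (at t within {a..b})"
      using dy[OF t] by (rule has_vector_derivative_scaleR)
    from has_vector_derivative_add[OF Suc this] show ?case
      by (simp add: z_def del: funpow.simps fact_Suc power_Suc)
  qed
  \<comment> \<open>Compactness of the interval gives a uniform bound \<open>Y\<close> on the
    trajectory, hence a bound on the one term that remains in the derivative of
    \<open>z n\<close>.\<close>
  have "continuous_on {a..b} y"
    using y by (rule continuous_on_vector_derivative)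
  then have "bounded (y ` {a..b})"
    by (intro compact_imp_bounded compact_continuous_image) auto
  then obtain Y where Y: "\<And>t. t \<in> {a..b} \<Longrightarrow> norm (y t) \<le> Y"
    unfolding bounded_iff by (metis imageI)
  \<comment> \<open>The derivative bound \<open>(b - a) ^ n / fact n * (K ^ Suc n * Y)\<close> times
    the interval length, regrouped as a constant times the \<open>n\<close>-th term of the
    exponential series at \<open>(b - a) * K\<close>. Terms of a convergent series tend to
    0.\<close>
  define e where "e n = (b - a) * K * Y * (inverse (fact n) * ((b - a) * K) ^ n)" for n
  have "norm (z n a - y b) \<le> e n" for n
  proof -
    have der_bound: "norm (((b - t) ^ n / fact n) *\<^sub>R (L ^^ Suc n) (y t))
        \<le> (b - a) ^ n / fact n * (K ^ Suc n * Y)" if t: "t \<in> {a..b}" for t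
    proof -
      have "norm ((L ^^ Suc n) (y t)) \<le> K ^ Suc n * Y"
        using K(1) Y[OF t] by (intro order_trans[OF K(2)] mult_left_mono) auto
      moreover have "\<bar>(b - t) ^ n / fact n\<bar> \<le> (b - a) ^ n / fact n"
        using t by (auto intro!: divide_right_mono power_mono simp: power_abs)
      ultimately show ?thesis
        unfolding norm_scaleR using ab by (intro mult_mono) auto
    qed
    \<comment> \<open>Mean value inequality on the convex set \<open>{a..b}\<close>.\<close>
    have "norm (z n a - z n b) \<le> (b - a) ^ n / fact n * (K ^ Suc n * Y) * norm (a - b)"
    proof (intro differentiable_bound[of "{a..b}" "z n"
          "\<lambda>t h. h *\<^sub>R (((b - t) ^ n / fact n) *\<^sub>R (L ^^ Suc n) (y t))"] onorm_le)
      show "(z n has_derivative (\<lambda>h. h *\<^sub>R (((b - t) ^ n / fact n) *\<^sub>R (L ^^ Suc n) (y t))))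
          (at t within {a..b})" if "t \<in> {a..b}" for t
        using dz[OF that] by (simp only: has_vector_derivative_def)
    next
      show "norm (h *\<^sub>R (((b - t) ^ n / fact n) *\<^sub>R (L ^^ Suc n) (y t)))
          \<le> (b - a) ^ n / fact n * (K ^ Suc n * Y) * norm h"
        if "t \<in> {a..b}" for t h
        using mult_right_mono[OF der_bound[OF that], of "norm h"]
        by (simp only: norm_scaleR[of h] real_norm_def mult.commute)
    qed (use ab in auto)
    \<comment> \<open>At \<open>s = b\<close> every power of \<open>b - s\<close> vanishes except
      the zeroth, which is 1.\<close>
    moreover have "z n b = y b"
      by (simp add: z_def power_0_left if_distrib[of "\<lambda>c. (c / _) *\<^sub>R _"] sum.delta cong: if_cong)
    moreover have "(b - a) ^ n / fact n * (K ^ Suc n * Y) * norm (a - b) = e n"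
      using ab by (simp add: e_def power_mult_distrib divide_inverse mult_ac)
    ultimately show ?thesis by simp
  qed
  moreover have "e \<longlonglongrightarrow> 0"
    unfolding e_def by (intro tendsto_mult_right_zero summable_LIMSEQ_zero summable_exp)
  ultimately have "(\<lambda>n. z n a - y b) \<longlonglongrightarrow> 0"
    using Lim_null_comparison[of "\<lambda>n. z n a - y b" e sequentially] by simp
  then show ?thesis
    unfolding sums_def_le z_def by (rule LIM_zero_cancel)
qed

section \<open>The matrix exponential as the flow of a linear system\<close>

lemma bounded_linear_matrix_mult_right: "bounded_linear ((**) (M :: real^'n^'n))"
  by (intro linear_conv_bounded_linear[THEN iffD1] linearI)
     (simp_all add: matrix_matrix_mult_def vec_eq_iff distrib_left sum.distrib sum_distrib_left mult_ac)

lemma bounded_linear_matrix_vector_mult_left: "bounded_linear (\<lambda>M :: real^'n^'n. M *v v)"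
  by (intro linear_conv_bounded_linear[THEN iffD1] linearI)
     (simp_all add: matrix_vector_mult_add_rdistrib scaleR_matrix_vector_assoc)

text \<open>Links the matrix powers inside \<open>mat_exp\<close> with the iterated operator in
  \<open>linear_ode_sums\<close>.\<close>

lemma matrix_funpow_mult_vector:
  "(((**) (M :: real^'n^'n) ^^ k) (mat 1)) *v v = ((*v) M ^^ k) v"
  by (induction k) (simp_all add: matrix_vector_mul_assoc[symmetric])

lemma mat_exp_mult_vector_sums:
  fixes M :: "real^'n^'n"
  shows "(\<lambda>k. ((*v) M ^^ k) v /\<^sub>R fact k) sums (mat_exp M *v v)"
proof -
  have "(\<lambda>k. ((**) M ^^ k) (mat 1) /\<^sub>R fact k) sums mat_exp M"
    unfolding mat_exp_def
    by (intro summable_sums summable_funpow_over_fact bounded_linear_matrix_mult_right)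
  from bounded_linear.sums[OF bounded_linear_matrix_vector_mult_left this, of v] show ?thesis
    by (simp add: scaleR_matrix_vector_assoc[symmetric] matrix_funpow_mult_vector)
qed

text \<open>\<open>linear_ode_sums\<close> and \<open>mat_exp_mult_vector_sums\<close> evaluate the
  same series, because \<open>k\<close> applications of the scaled matrix pull out the factor
  \<open>(b - a) ^ k\<close>; limits are unique. Since \<open>y\<close> is an arbitrary solution,
  uniqueness of solutions is included.\<close>

lemma linear_ode_mat_exp:
  fixes A :: "real^'n^'n"
  assumes "a \<le> b"
    and "\<And>t. t \<in> {a..b} \<Longrightarrow> (y has_vector_derivative A *v y t) (at t within {a..b})"
  shows "y b = mat_exp ((b - a) *\<^sub>R A) *v y a"
proof -
  have "((*v) ((b - a) *\<^sub>R A) ^^ k) v = (b - a) ^ k *\<^sub>R ((*v) A ^^ k) v" for k v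
    by (induction k) (simp_all add: scaleR_matrix_vector_assoc[symmetric] matrix_vector_mult_scaleR mult.commute)
  then have "(\<lambda>k. ((b - a) ^ k / fact k) *\<^sub>R ((*v) A ^^ k) (y a))
      sums (mat_exp ((b - a) *\<^sub>R A) *v y a)"
    using mat_exp_mult_vector_sums[of "(b - a) *\<^sub>R A" "y a"]
    by (simp add: divide_inverse mult.commute)
  with linear_ode_sums[OF matrix_vector_mul_bounded_linear assms] show ?thesis
    by (rule sums_unique2)
qed

section \<open>Quadratic forms and the growth of the Lyapunov function over one tick\<close>

lemma pos_def_matrix_lower_bound:
  fixes P :: "real^'n^'n"
  assumes "pos_def_matrix P"
  obtains c where "0 < c" "\<And>x. c * (norm x)\<^sup>2 \<le> x \<bullet> (P *v x)"
proof -
  have "continuous_on (sphere 0 1) (\<lambda>x. x \<bullet> (P *v x))"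
    by (intro continuous_intros linear_continuous_on matrix_vector_mul_bounded_linear)
  moreover have "sphere (0 :: real^'n) 1 \<noteq> {}"
    by simp
  ultimately obtain u where u: "u \<in> sphere 0 1"
      "\<And>x. x \<in> sphere 0 1 \<Longrightarrow> u \<bullet> (P *v u) \<le> x \<bullet> (P *v x)"
    using continuous_attains_inf[OF compact_sphere] by blast
  \<comment> \<open>The minimum over the compact unit sphere transfers to every \<open>x\<close>
    because the form is homogeneous of degree 2.\<close>
  have "u \<bullet> (P *v u) * (norm x)\<^sup>2 \<le> x \<bullet> (P *v x)" for x
  proof (cases "x = 0")
    case False
    then have "u \<bullet> (P *v u) \<le> (x /\<^sub>R norm x) \<bullet> (P *v (x /\<^sub>R norm x))"
      by (intro u(2)) simp
    with False show ?thesis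
      by (simp add: matrix_vector_mult_scaleR power2_eq_square field_simps)
  qed simp
  moreover have "u \<noteq> 0"
    using u(1) by auto
  then have "0 < u \<bullet> (P *v u)"
    using assms by (simp add: pos_def_matrix_def)
  ultimately show ?thesis
    using that by blast
qed

text \<open>A real supremum dominates its set only when the set is bounded above, so this is what
  makes \<open>one_tick_gain\<close> a usable bound. The numerator is at most
  \<open>K * (norm x)\<^sup>2\<close> by Cauchy-Schwarz, the denominator at least
  \<open>c * (norm x)\<^sup>2\<close>.\<close>

lemma bdd_above_quadratic_quotient:
  fixes P Q :: "real^'n^'n"
  assumes "pos_def_matrix P"
  shows "bdd_above ((\<lambda>x. sqrt ((x \<bullet> (Q *v x)) / (x \<bullet> (P *v x)))) ` {x. x \<noteq> 0})"
proof -
  obtain c where c: "0 < c" "\<And>x. c * (norm x)\<^sup>2 \<le> x \<bullet> (P *v x)"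
    using pos_def_matrix_lower_bound[OF assms] by blast
  obtain K where K: "0 < K" "\<And>x. norm (Q *v x) \<le> norm x * K"
    using bounded_linear.pos_bounded[OF matrix_vector_mul_bounded_linear[of Q]] by blast
  have "(x \<bullet> (Q *v x)) / (x \<bullet> (P *v x)) \<le> K / c" if "x \<noteq> 0" for x
  proof -
    have pos: "0 < x \<bullet> (P *v x)"
      using assms that by (simp add: pos_def_matrix_def)
    have "x \<bullet> (Q *v x) \<le> norm x * (norm x * K)"
      by (rule order_trans[OF norm_cauchy_schwarz mult_left_mono[OF K(2)]]) simp
    also have "\<dots> = K / c * (c * (norm x)\<^sup>2)"
      using c(1) by (simp add: power2_eq_square)
    also have "\<dots> \<le> K / c * (x \<bullet> (P *v x))"
      using c K(1) by (intro mult_left_mono) auto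
    finally show ?thesis
      using pos by (simp add: pos_divide_le_eq)
  qed
  then show ?thesis
    by (intro bdd_aboveI2[where M = "sqrt (K / c)"]) auto
qed

text \<open>The gain is a supremum of square roots of the quotient \<open>q\<close>, so it enters
  squared. The supremum omits \<open>x = 0\<close>, where both sides vanish.\<close>

lemma one_tick_gain_bound:
  fixes A P :: "real^'n^'n" and \<tau> :: real
  assumes P: "pos_def_matrix P"
  defines "E \<equiv> mat_exp (\<tau> *\<^sub>R A)"
  shows "(E *v x) \<bullet> (P *v (E *v x)) \<le> (one_tick_gain A P \<tau>)\<^sup>2 * (x \<bullet> (P *v x))"
proof (cases "x = 0")
  case False
  define q where "q = ((E *v x) \<bullet> (P *v (E *v x))) / (x \<bullet> (P *v x))"
  have pos: "0 < x \<bullet> (P *v x)" and nonneg: "0 \<le> (E *v x) \<bullet> (P *v (E *v x))"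
    using P False by (auto simp: pos_def_matrix_def) (metis inner_zero_left less_eq_real_def)
  \<comment> \<open>The transpose of \<open>E\<close> moves across the inner product.\<close>
  have "x \<bullet> ((transpose E ** P ** E) *v x) = (E *v x) \<bullet> (P *v (E *v x))"
    by (metis dot_lmul_matrix inner_commute matrix_vector_mul_assoc transpose_matrix_vector)
  then have "sqrt q \<le> one_tick_gain A P \<tau>"
    using cSUP_upper[OF _ bdd_above_quadratic_quotient[OF P], of x "transpose E ** P ** E"] False
    by (simp add: one_tick_gain_def q_def E_def)
  moreover have "0 \<le> q"
    using pos nonneg by (simp add: q_def)
  ultimately have "q \<le> (one_tick_gain A P \<tau>)\<^sup>2"
    by (metis real_sqrt_ge_zero power_mono real_sqrt_pow2)
  then show ?thesis
    using pos by (simp add: q_def pos_divide_le_eq)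
qed simp

text \<open>The equilibrium equation cancels the constant input, so the deviation
  \<open>x t - xeq\<close> solves the homogeneous equation and is multiplied by the matrix
  exponential over the interval.\<close>

lemma lyapunov_tick:
  fixes A P :: "real^'n^'n" and B :: "real^'m^'n"
  assumes eq: "A *v xeq + B *v ueq = 0" and P: "pos_def_matrix P" and "a \<le> b"
    and x: "solves_on A B ueq x a b"
  shows "lyapunov P xeq (x b) \<le> (one_tick_gain A P (b - a))\<^sup>2 * lyapunov P xeq (x a)"
proof -
  have "A *v x t + B *v ueq = A *v (x t - xeq)" for t
    using eq by (simp add: matrix_vector_mult_diff_distrib eq_neg_iff_add_eq_0[symmetric])
  then have "((\<lambda>t. x t - xeq) has_vector_derivative A *v (x t - xeq)) (at t within {a..b})"
    if "t \<in> {a..b}" for t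
    using x that unfolding solves_on_def by (auto intro!: derivative_eq_intros)
  from linear_ode_mat_exp[OF \<open>a \<le> b\<close> this] show ?thesis
    using one_tick_gain_bound[OF P, of "b - a" A "x a - xeq"] by (simp add: lyapunov_def)
qed

section \<open>Decisions and ticks of a jammed run\<close>

lemma solves_on_subset:
  assumes "solves_on A B u x a b" "a \<le> c" "d \<le> b"
  shows "solves_on A B u x c d"
  unfolding solves_on_def
proof
  fix t
  assume "t \<in> {c..d}"
  with assms have "(x has_vector_derivative A *v x t + B *v u) (at t within {a..b})"
    by (auto simp: solves_on_def)
  then show "(x has_vector_derivative A *v x t + B *v u) (at t within {c..d})"
    by (rule has_vector_derivative_within_subset) (use assms in auto)
qed

lemma jam_run_unfold:
  assumes "jam_run A B \<tau> stc u0 x0 N i w x"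
  defines "c k \<equiv> stc (real (i k) * \<tau>) (x (real (i k) * \<tau>))"
  shows "i (Suc k) = i k + snd (c k)"
    and "w k = (if i k < N then (case k of 0 \<Rightarrow> u0 | Suc j \<Rightarrow> w j) else fst (c k))"
    and "solves_on A B (w k) x (real (i k) * \<tau>) (real (i (Suc k)) * \<tau>)"
proof -
  have "i (Suc k) = i k + snd (c k) \<and>
      w k = (if i k < N then (case k of 0 \<Rightarrow> u0 | Suc j \<Rightarrow> w j) else fst (c k)) \<and>
      solves_on A B (w k) x (real (i k) * \<tau>) (real (i (Suc k)) * \<tau>)"
    using assms(1) unfolding jam_run_def Let_def case_prod_beta c_def by blast
  then show "i (Suc k) = i k + snd (c k)"
    and "w k = (if i k < N then (case k of 0 \<Rightarrow> u0 | Suc j \<Rightarrow> w j) else fst (c k))"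
    and "solves_on A B (w k) x (real (i k) * \<tau>) (real (i (Suc k)) * \<tau>)"
    by auto
qed

text \<open>Decision indices never decrease, so if decision \<open>Suc k\<close> falls in the jam
  window then so does decision \<open>k\<close>, and the held input is inherited back to
  \<open>u0\<close>.\<close>

lemma jam_run_held_input:
  assumes run: "jam_run A B \<tau> stc u0 x0 N i w x" and "i k < N"
  shows "w k = u0"
  using \<open>i k < N\<close>
proof (induction k)
  case 0
  then show ?case using jam_run_unfold(2)[OF run, of 0] by simp
next
  case (Suc k)
  then show ?case
    using jam_run_unfold(1)[OF run, of k] jam_run_unfold(2)[OF run, of "Suc k"] by simp
qed

text \<open>Dwell times of at least one tick make \<open>i\<close> strictly increasing from 0, so
  its dwell intervals leave no tick out.\<close>

lemma jam_run_tick_covered: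
  assumes run: "jam_run A B \<tau> stc u0 x0 N i w x" and dwell: "\<And>t y. 1 \<le> snd (stc t y)"
  shows "\<exists>k. i k \<le> j \<and> j < i (Suc k)"
proof (induction j)
  have step: "i k < i (Suc k)" for k
    using jam_run_unfold(1)[OF run, of k] dwell by (simp add: Suc_le_eq)
  {
    case 0
    show ?case
      using run step[of 0] by (intro exI[of _ 0]) (simp add: jam_run_def)
  next
    case (Suc j)
    then obtain k where "i k \<le> j" "j < i (Suc k)" by blast
    then show ?case
      \<comment> \<open>Either tick \<open>Suc j\<close> is still in dwell interval
        \<open>k\<close>, or it is exactly \<open>i (Suc k)\<close> and opens the next one.\<close>
      using step[of "Suc k"] by (cases "Suc j < i (Suc k)") (auto intro: exI[of _ k] exI[of _ "Suc k"])
  }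
qed

text \<open>A dwell interval may span several ticks and outlast the window, but the one containing a
  jammed tick began no later than that tick, hence inside the window, and carries
  \<open>u0\<close>.\<close>

lemma jam_run_solves_tick:
  assumes run: "jam_run A B \<tau> stc u0 x0 N i w x" and dwell: "\<And>t y. 1 \<le> snd (stc t y)"
    and "0 \<le> \<tau>" "j < N"
  shows "solves_on A B u0 x (real j * \<tau>) (real (Suc j) * \<tau>)"
proof -
  obtain k where k: "i k \<le> j" "j < i (Suc k)"
    using jam_run_tick_covered[OF run dwell] by blast
  then have "w k = u0"
    using jam_run_held_input[OF run, of k] \<open>j < N\<close> by simp
  then have "solves_on A B u0 x (real (i k) * \<tau>) (real (i (Suc k)) * \<tau>)"
    using jam_run_unfold(3)[OF run, of k] by simp
  then show ?thesis
    using k \<open>0 \<le> \<tau>\<close> by (elim solves_on_subset) (auto intro!: mult_right_mono simp del: of_nat_Suc)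
qed

text \<open>Here the input delivered before the window is \<open>ueq\<close>, so
  \<open>lyapunov_tick\<close> applies to each jammed tick and the factors multiply.\<close>

lemma jam_run_lyapunov_bound:
  fixes A P :: "real^'n^'n" and B :: "real^'m^'n"
  assumes eq: "A *v xeq + B *v ueq = 0" and P: "pos_def_matrix P" and \<tau>: "0 \<le> \<tau>"
    and dwell: "\<And>t y. 1 \<le> snd (stc t y)"
    and run: "jam_run A B \<tau> stc ueq x0 N i w x" and "j \<le> N"
  shows "lyapunov P xeq (x (real j * \<tau>)) \<le> ((one_tick_gain A P \<tau>)\<^sup>2) ^ j * lyapunov P xeq x0"
  using \<open>j \<le> N\<close>
proof (induction j)
  case 0
  then show ?case using run by (simp add: jam_run_def)
next
  case (Suc j)
  have "real (Suc j) * \<tau> - real j * \<tau> = \<tau>"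
    by (simp add: algebra_simps)
  then have "lyapunov P xeq (x (real (Suc j) * \<tau>))
      \<le> (one_tick_gain A P \<tau>)\<^sup>2 * lyapunov P xeq (x (real j * \<tau>))"
    using lyapunov_tick[OF eq P _ jam_run_solves_tick[OF run dwell \<tau>, of j]] Suc.prems \<tau>
    by (simp add: mult_right_mono del: of_nat_Suc)
  also have "\<dots> \<le> (one_tick_gain A P \<tau>)\<^sup>2 * (((one_tick_gain A P \<tau>)\<^sup>2) ^ j * lyapunov P xeq x0)"
    using Suc by (intro mult_left_mono) auto
  finally show ?case by (simp add: mult_ac)
qed

theorem theorem1:
  fixes A :: "real^'n^'n" and B :: "real^'m^'n" and P :: "real^'n^'n"
    and xeq x0 :: "real^'n" and ueq :: "real^'m"
    and \<tau>min lam Vcrit V0 G1 :: real and N\<tau> :: nat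
    and V :: "real^'n \<Rightarrow> real"
    and stc :: "real \<Rightarrow> real^'n \<Rightarrow> (real^'m) \<times> nat"
    and Nstar :: enat
  assumes equilibrium: "A *v xeq + B *v ueq = 0"
    and P: "pos_def_matrix P"
    and V: "V = lyapunov P xeq"
    and \<tau>min: "0 < \<tau>min"
    and Vcrit: "0 < Vcrit"
    and G1: "G1 = one_tick_gain A P \<tau>min"
    and N\<tau>: "1 \<le> N\<tau>"
    and dwell: "\<And>t y. snd (stc t y) \<in> {1..N\<tau>}"
    and lam: "0 < lam"
    and contract: "\<And>N i w x. jam_run A B \<tau>min stc ueq x0 N i w x \<Longrightarrow>
                     decay_contract V lam \<tau>min N i x"
    and V0: "V x0 = V0" "0 < V0" "V0 < Vcrit"
    and gain: "1 < G1"
    and Nstar: "Nstar = min_crash_ticks A B \<tau>min stc ueq x0 V Vcrit"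
  shows "enat (nat \<lceil>ln (Vcrit / V0) / (2 * ln G1)\<rceil>) \<le> Nstar"
proof -
  have "enat (nat \<lceil>ln (Vcrit / V0) / (2 * ln G1)\<rceil>) \<le> enat N"
    if run: "jam_run A B \<tau>min stc ueq x0 N i w x" and crash: "Vcrit \<le> V (x (real N * \<tau>min))"
    for N i w x
  proof -
    have "1 \<le> snd (stc t y)" for t y
      using dwell[of t y] by simp
    then have "Vcrit \<le> (G1\<^sup>2) ^ N * V0"
      using crash jam_run_lyapunov_bound[OF equilibrium P _ _ run order_refl] \<tau>min V0(1)
      by (force simp: V G1)
    then have "Vcrit / V0 \<le> (G1\<^sup>2) ^ N"
      using V0(2) by (simp add: pos_divide_le_eq)
    \<comment> \<open>Taking logarithms turns the geometric growth into a linear bound on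
      \<open>N\<close>; \<open>1 < G1\<close> makes the later divisor \<open>2 * ln G1\<close>
      positive.\<close>
    then have "ln (Vcrit / V0) \<le> ln ((G1\<^sup>2) ^ N)"
      using Vcrit V0(2) gain by (subst ln_le_cancel_iff) auto
    also have "\<dots> = real N * (2 * ln G1)"
      using gain by (simp add: ln_realpow)
    finally have "ln (Vcrit / V0) / (2 * ln G1) \<le> real N"
      using gain by (simp add: pos_divide_le_eq)
    \<comment> \<open>\<open>N\<close> is an integer, so the bound survives rounding up. The ceiling
      is positive because \<open>V0 < Vcrit\<close> and \<open>1 < G1\<close>, so \<open>nat\<close>
      does not alter its value.\<close>
    then show ?thesis
      by (simp add: ceiling_le_iff nat_le_iff)
  qed
  \<comment> \<open>A bound valid for every crashing \<open>N\<close> passes to the infimum; with no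
    crashing \<open>N\<close> the infimum is infinity and the inequality still holds.\<close>
  then show ?thesis
    unfolding Nstar min_crash_ticks_def by (intro Inf_greatest) blast
qed

end
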